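(* Let $J\subset\mathbb{R}^+$ be an interval with $(0,1)\subset J$, let $h:J\to\mathbb{R}^+$ be a non-zero super-multiplicative function, and let $f$ be an operator $(1,h)$-convex function on $\mathbb{R}^+$ such that $f(0)=0$. Then for any positive definite matrices $A\le B$, $$A^{-1}f(A)\le 2h(1/2)\,B^{-1}f(B).$$ Moreover, in the case when $2h(1/2)\le1$, the function $t\mapsto t^{-1}f(t)$ is operator monotone on $(0,\infty)$, and hence the function $f$ is operator convex (on $\mathbb{R}^+$).
   Context: $\mathbb{R}^+=[0,\infty)$. $\mathbb{M}_n^+$ is the set of positive semidefinite $n\times n$ complex matrices; $A\le B$ means $B-A\in\mathbb{M}_n^+$; functions of self-adjoint matrices are defined by functional calculus. A function $h:J\to\mathbb{R}^+$ is super-multiplicative if $h(xy)\ge h(x)h(y)$ for all $x,y\in J$ (with $xy\in J$); non-zero means not identically zero. A non-negative continuous function $f:\mathbb{R}^+\to\mathbb{R}$ is operator $(1,h)$-convex on $\mathbb{R}^+$ if $$f(\alpha A+(1-\alpha)B)\le h(\alpha)f(A)+h(1-\alpha)f(B)$$ for every $n\ge1$, all $A,B\in\mathbb{M}_n^+$, and all $\alpha\in(0,1)$. Operator convex is the same notion with $h(\alpha)=\alpha$ (without requiring non-negativity). Operator monotone on $(0,\infty)$ means $A\le B$ implies $g(A)\le g(B)$ for positive definite matrices $A,B$ of any order. *)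

theory Defs
  imports
    "HOL-Analysis.Topology_Euclidean_Space"
    "Jordan_Normal_Form.Gauss_Jordan_Elimination"
    "Jordan_Normal_Form.Schur_Decomposition"
begin

text \<open>
  Square complex matrices of order \<open>n\<close> are the elements of \<^term>\<open>carrier_mat n n\<close>, so that
  operator convexity and monotonicity can quantify over the order. Scalar functions on a
  subset of the reals are total functions of which only the values on that subset matter.
\<close>

definition hermitian_mat :: "complex mat \<Rightarrow> bool" where
  "hermitian_mat A \<longleftrightarrow> mat_adjoint A = A"

definition unitary_mat :: "nat \<Rightarrow> complex mat \<Rightarrow> bool" where
  "unitary_mat n U \<longleftrightarrow>
     U \<in> carrier_mat n n \<and> mat_adjoint U * U = 1\<^sub>m n \<and> U * mat_adjoint U = 1\<^sub>m n"

text \<open>The quadratic form of a Hermitian matrix is real, so taking \<^term>\<open>Re\<close> loses nothing.\<close>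

definition pos_semidef :: "nat \<Rightarrow> complex mat \<Rightarrow> bool" where
  "pos_semidef n A \<longleftrightarrow> A \<in> carrier_mat n n \<and> hermitian_mat A \<and>
     (\<forall>v \<in> carrier_vec n. 0 \<le> Re ((A *\<^sub>v v) \<bullet>c v))"

definition pos_def :: "nat \<Rightarrow> complex mat \<Rightarrow> bool" where
  "pos_def n A \<longleftrightarrow> A \<in> carrier_mat n n \<and> hermitian_mat A \<and>
     (\<forall>v \<in> carrier_vec n. v \<noteq> 0\<^sub>v n \<longrightarrow> 0 < Re ((A *\<^sub>v v) \<bullet>c v))"

definition loewner_le :: "nat \<Rightarrow> complex mat \<Rightarrow> complex mat \<Rightarrow> bool" where
  "loewner_le n A B \<longleftrightarrow>
     A \<in> carrier_mat n n \<and> B \<in> carrier_mat n n \<and> pos_semidef n (B - A)"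

text \<open>
  Functional calculus: if \<open>A = U diag(d) U*\<close> with \<open>U\<close> unitary and \<open>d\<close> real, then
  \<open>f(A) = U diag(f(d)) U*\<close>. Every Hermitian matrix has such a decomposition, and the
  result does not depend on which one is chosen. For other matrices the value is unspecified.
\<close>

definition mat_fun :: "(real \<Rightarrow> real) \<Rightarrow> complex mat \<Rightarrow> complex mat" where
  "mat_fun f A = (THE B. \<exists>U d. unitary_mat (dim_row A) U \<and>
     A = U * mat_diag (dim_row A) (\<lambda>i. complex_of_real (d i)) * mat_adjoint U \<and>
     B = U * mat_diag (dim_row A) (\<lambda>i. complex_of_real (f (d i))) * mat_adjoint U)"

text \<open>The value is unspecified when \<open>A\<close> is not invertible.\<close>

definition mat_inv :: "complex mat \<Rightarrow> complex mat" where
  "mat_inv A = the (mat_inverse A)"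

definition super_multiplicative_on :: "real set \<Rightarrow> (real \<Rightarrow> real) \<Rightarrow> bool" where
  "super_multiplicative_on J h \<longleftrightarrow>
     (\<forall>x \<in> J. \<forall>y \<in> J. x * y \<in> J \<longrightarrow> h x * h y \<le> h (x * y))"

definition operator_h_inequality :: "(real \<Rightarrow> real) \<Rightarrow> (real \<Rightarrow> real) \<Rightarrow> bool" where
  "operator_h_inequality h f \<longleftrightarrow>
     (\<forall>n \<ge> 1. \<forall>A B \<alpha>. pos_semidef n A \<longrightarrow> pos_semidef n B \<longrightarrow> 0 < \<alpha> \<longrightarrow> \<alpha> < 1 \<longrightarrow>
        loewner_le n
          (mat_fun f (complex_of_real \<alpha> \<cdot>\<^sub>m A + complex_of_real (1 - \<alpha>) \<cdot>\<^sub>m B))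
          (complex_of_real (h \<alpha>) \<cdot>\<^sub>m mat_fun f A + complex_of_real (h (1 - \<alpha>)) \<cdot>\<^sub>m mat_fun f B))"

definition operator_1h_convex :: "(real \<Rightarrow> real) \<Rightarrow> (real \<Rightarrow> real) \<Rightarrow> bool" where
  "operator_1h_convex h f \<longleftrightarrow>
     continuous_on {0..} f \<and> (\<forall>t \<ge> 0. 0 \<le> f t) \<and> operator_h_inequality h f"

definition operator_convex :: "(real \<Rightarrow> real) \<Rightarrow> bool" where
  "operator_convex f \<longleftrightarrow> continuous_on {0..} f \<and> operator_h_inequality (\<lambda>\<alpha>. \<alpha>) f"

definition operator_monotone_pos :: "(real \<Rightarrow> real) \<Rightarrow> bool" where
  "operator_monotone_pos g \<longleftrightarrow>
     (\<forall>n \<ge> 1. \<forall>A B. pos_def n A \<longrightarrow> pos_def n B \<longrightarrow> loewner_le n A B \<longrightarrow>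
        loewner_le n (mat_fun g A) (mat_fun g B))"

end

theory Submission
  imports Defs "HOL-Computational_Algebra.Fundamental_Theorem_Algebra"
begin

text \<open>
  Averaging a positive matrix over a reflection that fixes the range of an isometry uses the
  convexity inequality only at \<open>\<alpha> = 1/2\<close>, and gives
  \<open>f(C* A C + E* B E) \<le> 2 h(1/2) (C* f(A) C + E* f(B) E)\<close> whenever \<open>C* C + E* E = 1\<close>.
  With \<open>B = 0\<close>, \<open>f(0) = 0\<close> and a contraction relating the two given matrices, this is the
  inequality for \<open>f(t) / t\<close>. With scalar \<open>C\<close>, \<open>E\<close> of squares \<open>\<alpha>\<close>, \<open>1 - \<alpha>\<close> and
  \<open>2 h(1/2) \<le> 1\<close>, it is operator convexity. The functional calculus enters through a single
  principle: \<open>A X = X B\<close> implies \<open>f(A) X = X f(B)\<close>, also for rectangular \<open>X\<close>.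
\<close>

subsection \<open>Matrices with explicit dimensions\<close>

abbreviation adj :: "complex mat \<Rightarrow> complex mat" where
  "adj \<equiv> mat_adjoint"

lemma dim_adj [simp]: "dim_row (adj A) = dim_col A" "dim_col (adj A) = dim_row A"
  by (simp_all add: mat_adjoint_def)

lemma adj_carrier: "A \<in> carrier_mat n m \<Longrightarrow> adj A \<in> carrier_mat m n"
  by (auto intro: carrier_matI)

lemma index_adj [simp]:
  "i < dim_col A \<Longrightarrow> j < dim_row A \<Longrightarrow> adj A $$ (i, j) = cnj (A $$ (j, i))"
  by (simp add: mat_adjoint_def mat_of_rows_def)

lemma adj_adj [simp]: "adj (adj A) = A"
  by (rule eq_matI) auto

lemma adj_mult:
  "dim_col A = dim_row B \<Longrightarrow> adj (A * B) = adj B * adj A"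
  by (rule eq_matI) (auto simp: scalar_prod_def mult.commute)

lemma adj_add:
  "dim_row A = dim_row B \<Longrightarrow> dim_col A = dim_col B \<Longrightarrow> adj (A + B) = adj A + adj B"
  by (rule eq_matI) auto

lemma adj_minus:
  "dim_row A = dim_row B \<Longrightarrow> dim_col A = dim_col B \<Longrightarrow> adj (A - B) = adj A - adj B"
  by (rule eq_matI) auto

lemma adj_smult: "adj (c \<cdot>\<^sub>m A) = cnj c \<cdot>\<^sub>m adj A"
  by (rule eq_matI) auto

lemma adj_one [simp]: "adj (1\<^sub>m n) = 1\<^sub>m n"
  by (rule eq_matI) auto

lemma adj_zero [simp]: "adj (0\<^sub>m n m) = 0\<^sub>m m n"
  by (rule eq_matI) auto

lemma dim_mat_diag [simp]: "dim_row (mat_diag n d) = n" "dim_col (mat_diag n d) = n"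
  by (simp_all add: mat_diag_def)

lemma adj_mat_diag [simp]:
  "adj (mat_diag n (\<lambda>i. complex_of_real (d i))) = mat_diag n (\<lambda>i. complex_of_real (d i))"
  by (rule eq_matI) (auto simp: mat_diag_def)

text \<open>The side conditions are equations between dimensions instead of carrier memberships, so
  that the simplifier can discharge them by computing \<open>dim_row\<close> and
  \<open>dim_col\<close>. The ring laws below have the same form.\<close>

lemma mult_mat_assoc:
  fixes A B C :: "complex mat"
  assumes "dim_col A = dim_row B" "dim_col B = dim_row C"
  shows "A * B * C = A * (B * C)"
  by (rule assoc_mult_mat[of _ "dim_row A" "dim_col A" _ "dim_col B" _ "dim_col C"])
    (use assms in auto)

lemma mult_mat_add_left:
  fixes A B C :: "complex mat"
  assumes "dim_row A = dim_row B" "dim_col A = dim_col B" "dim_col B = dim_row C"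
  shows "(A + B) * C = A * C + B * C"
  by (rule add_mult_distrib_mat[of _ "dim_row A" "dim_col A" _ _ "dim_col C"])
    (use assms in auto)

lemma mult_mat_add_right:
  fixes A B C :: "complex mat"
  assumes "dim_row B = dim_row C" "dim_col B = dim_col C" "dim_col A = dim_row C"
  shows "A * (B + C) = A * B + A * C"
  by (rule mult_add_distrib_mat[of _ "dim_row A" "dim_col A" _ "dim_col C"])
    (use assms in auto)

lemma mult_mat_minus_left:
  fixes A B C :: "complex mat"
  assumes "dim_row A = dim_row B" "dim_col A = dim_col B" "dim_col B = dim_row C"
  shows "(A - B) * C = A * C - B * C"
  by (rule minus_mult_distrib_mat[of _ "dim_row A" "dim_col A" _ _ "dim_col C"])
    (use assms in auto)

lemma mult_mat_minus_right:
  fixes A B C :: "complex mat"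
  assumes "dim_row B = dim_row C" "dim_col B = dim_col C" "dim_col A = dim_row C"
  shows "A * (B - C) = A * B - A * C"
  by (rule mult_minus_distrib_mat[of _ "dim_row A" "dim_col A" _ "dim_col C"])
    (use assms in auto)

lemma mult_mat_smult_right:
  fixes A B :: "complex mat"
  assumes "dim_col A = dim_row B"
  shows "A * (c \<cdot>\<^sub>m B) = c \<cdot>\<^sub>m (A * B)"
  by (rule mult_smult_distrib[of _ "dim_row A" "dim_col A" _ "dim_col B"])
    (use assms in auto)

lemma mult_mat_smult_left:
  fixes A B :: "complex mat"
  assumes "dim_col A = dim_row B"
  shows "(c \<cdot>\<^sub>m A) * B = c \<cdot>\<^sub>m (A * B)"
  by (rule mult_smult_assoc_mat[of _ "dim_row A" "dim_col A" _ "dim_col B"])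
    (use assms in auto)

lemma mult_mat_one_left: "dim_row A = n \<Longrightarrow> 1\<^sub>m n * (A :: complex mat) = A"
  by (rule left_mult_one_mat[of _ n "dim_col A"]) auto

lemma mult_mat_one_right: "dim_col A = n \<Longrightarrow> (A :: complex mat) * 1\<^sub>m n = A"
  by (rule right_mult_one_mat[of _ "dim_row A" n]) auto

lemma mult_mat_zero_left: "dim_row A = m \<Longrightarrow> 0\<^sub>m n m * (A :: complex mat) = 0\<^sub>m n (dim_col A)"
  by (rule left_mult_zero_mat[of _ m "dim_col A" n]) auto

lemma mult_mat_zero_right: "dim_col A = n \<Longrightarrow> (A :: complex mat) * 0\<^sub>m n m = 0\<^sub>m (dim_row A) m"
  by (rule right_mult_zero_mat[of _ "dim_row A" n m]) auto

lemma add_mat_zero_left: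
  "dim_row A = n \<Longrightarrow> dim_col A = m \<Longrightarrow> 0\<^sub>m n m + (A :: complex mat) = A"
  by (rule eq_matI) auto

lemma add_mat_zero_right:
  "dim_row A = n \<Longrightarrow> dim_col A = m \<Longrightarrow> (A :: complex mat) + 0\<^sub>m n m = A"
  by (rule eq_matI) auto

text \<open>A normal form: products associated to the right, sums and differences multiplied out,
  scalars pulled out of products.\<close>

lemmas mat_ring_simps =
  mult_mat_assoc mult_mat_add_left mult_mat_add_right mult_mat_minus_left mult_mat_minus_right
  mult_mat_smult_left mult_mat_smult_right mult_mat_one_left mult_mat_one_right
  mult_mat_zero_left mult_mat_zero_right add_mat_zero_left add_mat_zero_right

lemmas adj_simps = adj_mult adj_add adj_minus adj_smult

text \<open>Once products are associated to the right, the factor \<open>A * B\<close> is no longer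
  a subterm of \<open>A * (B * X)\<close>. This rule and the next let a known value 1 or 0 of
  \<open>A * B\<close> act there all the same.\<close>

lemma mult_left_cancel_mat:
  fixes A B X :: "complex mat"
  assumes "A * B = 1\<^sub>m n" "dim_col A = dim_row B" "dim_row X = n"
  shows "A * (B * X) = X"
proof -
  have "dim_col B = n"
    using arg_cong[OF assms(1), of dim_col] by simp
  then have "A * (B * X) = A * B * X"
    using assms mult_mat_assoc[of A B X] by simp
  then show ?thesis
    using assms by (simp add: mult_mat_one_left)
qed

lemma mult_left_annihilate_mat:
  fixes A B X :: "complex mat"
  assumes "A * B = 0\<^sub>m n m" "dim_col A = dim_row B" "dim_row X = m"
  shows "A * (B * X) = 0\<^sub>m n (dim_col X)"
proof -
  have "dim_col B = m"
    using arg_cong[OF assms(1), of dim_col] by simp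
  then have "A * (B * X) = A * B * X"
    using assms mult_mat_assoc[of A B X] by simp
  then show ?thesis
    using assms by (simp add: mult_mat_zero_left)
qed

section \<open>Inclusions of the two summands of a direct sum\<close>

text \<open>Block matrices are written as sums such as \<open>P * A * adj P + Q * B * adj Q\<close>,
  where the isometries \<open>P\<close> and \<open>Q\<close> include the first k and the last m
  coordinates. Block computations then become ring computations.\<close>

definition inl_mat :: "nat \<Rightarrow> nat \<Rightarrow> complex mat" where
  "inl_mat k m = mat (k + m) k (\<lambda>(i, j). if i = j then 1 else 0)"

definition inr_mat :: "nat \<Rightarrow> nat \<Rightarrow> complex mat" where
  "inr_mat k m = mat (k + m) m (\<lambda>(i, j). if i = k + j then 1 else 0)"

lemma dim_inl_inr [simp]:
  "dim_row (inl_mat k m) = k + m" "dim_col (inl_mat k m) = k"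
  "dim_row (inr_mat k m) = k + m" "dim_col (inr_mat k m) = m"
  by (simp_all add: inl_mat_def inr_mat_def)

lemma index_inl_mult:
  assumes "dim_row X = k" "i < k + m" "j < dim_col X"
  shows "(inl_mat k m * X) $$ (i, j) = (if i < k then X $$ (i, j) else 0)"
  using assms
  by (auto simp: inl_mat_def scalar_prod_def if_distrib[of "\<lambda>x. x * _"] cong: if_cong)

lemma index_inr_mult:
  assumes "dim_row X = m" "i < k + m" "j < dim_col X"
  shows "(inr_mat k m * X) $$ (i, j) = (if i < k then 0 else X $$ (i - k, j))"
proof -
  have "(inr_mat k m * X) $$ (i, j) = (\<Sum>l<m. if i = k + l then X $$ (l, j) else 0)"
    using assms
    by (auto simp: inr_mat_def scalar_prod_def lessThan_atLeast0 intro!: sum.cong)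
  \<comment> \<open>For i < k the truncated difference i - k is 0, which may be a value of l; the
    inner conditional removes that term.\<close>
  also have "\<dots> = (\<Sum>l<m. if l = i - k then (if i < k then 0 else X $$ (i - k, j)) else 0)"
    by (rule sum.cong) auto
  also have "\<dots> = (if i < k then 0 else X $$ (i - k, j))"
    using assms by auto
  finally show ?thesis .
qed

lemma inl_inr_orthonormal:
  "adj (inl_mat k m) * inl_mat k m = 1\<^sub>m k"
  "adj (inr_mat k m) * inr_mat k m = 1\<^sub>m m"
  "adj (inl_mat k m) * inr_mat k m = 0\<^sub>m k m"
  "adj (inr_mat k m) * inl_mat k m = 0\<^sub>m m k"
proof -
  \<comment> \<open>Multiplication by the adjoints cuts out the first k rows (\<open>l\<close>) and
    the last m rows (\<open>r\<close>).\<close>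
  have l: "adj (inl_mat k m) * X = mat k (dim_col X) (\<lambda>(i, j). X $$ (i, j))"
    if "dim_row X = k + m" for X
    using that
    by (intro eq_matI)
      (auto simp: inl_mat_def scalar_prod_def if_distrib[of cnj] if_distrib[of "\<lambda>x. x * _"] cong: if_cong)
  have r: "adj (inr_mat k m) * X = mat m (dim_col X) (\<lambda>(i, j). X $$ (k + i, j))"
    if "dim_row X = k + m" for X
    using that
    by (intro eq_matI)
      (auto simp: inr_mat_def scalar_prod_def if_distrib[of cnj] if_distrib[of "\<lambda>x. x * _"] cong: if_cong)
  show "adj (inl_mat k m) * inl_mat k m = 1\<^sub>m k"
    by (simp add: l) (rule eq_matI, auto simp: inl_mat_def)
  show "adj (inr_mat k m) * inr_mat k m = 1\<^sub>m m"
    by (simp add: r) (rule eq_matI, auto simp: inr_mat_def)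
  show "adj (inl_mat k m) * inr_mat k m = 0\<^sub>m k m"
    by (simp add: l) (rule eq_matI, auto simp: inr_mat_def)
  show "adj (inr_mat k m) * inl_mat k m = 0\<^sub>m m k"
    by (simp add: r) (rule eq_matI, auto simp: inl_mat_def)
qed

lemma inl_inr_complete:
  "inl_mat k m * adj (inl_mat k m) + inr_mat k m * adj (inr_mat k m) = 1\<^sub>m (k + m)"
  by (rule eq_matI) (auto simp del: index_mult_mat(1) simp: index_inl_mult index_inr_mult,
      auto simp: inl_mat_def inr_mat_def)

text \<open>Used to join a split-off eigenvalue to the diagonal form of the remaining block.\<close>

lemma inl_inr_diag:
  "inl_mat k m * mat_diag k d * adj (inl_mat k m) + inr_mat k m * mat_diag m e * adj (inr_mat k m)
     = mat_diag (k + m) (\<lambda>i. if i < k then d i else e (i - k))"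
proof -
  have l: "mat_diag k d * adj (inl_mat k m) = mat k (k + m) (\<lambda>(i, j). d i * adj (inl_mat k m) $$ (i, j))"
    by (rule mat_diag_mult_left) (auto intro: carrier_matI)
  have r: "mat_diag m e * adj (inr_mat k m) = mat m (k + m) (\<lambda>(i, j). e i * adj (inr_mat k m) $$ (i, j))"
    by (rule mat_diag_mult_left) (auto intro: carrier_matI)
  show ?thesis
    by (simp add: mult_mat_assoc l r, rule eq_matI)
      (auto simp del: index_mult_mat(1) simp: index_inl_mult index_inr_mult mat_diag_def,
       auto simp: inl_mat_def inr_mat_def)
qed

subsection \<open>Unitary diagonalization\<close>

lemma hermitian_mat_square:
  assumes "hermitian_mat A" "A \<in> carrier_mat n n" "X \<in> carrier_mat n m"
  shows "hermitian_mat (adj X * A * X)"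
  using assms by (auto simp: hermitian_mat_def adj_simps mat_ring_simps)

lemma unitary_matD:
  assumes "unitary_mat n U"
  shows "dim_row U = n" "dim_col U = n" "adj U * U = 1\<^sub>m n" "U * adj U = 1\<^sub>m n"
  using assms by (auto simp: unitary_mat_def)

lemma unitary_matI:
  assumes "U \<in> carrier_mat n n" "adj U * U = 1\<^sub>m n"
  shows "unitary_mat n U"
  using assms mat_mult_left_right_inverse[of "adj U" n U]
  by (auto simp: unitary_mat_def adj_carrier)

lemma unitary_mat_mult:
  assumes "unitary_mat n U" "unitary_mat n V"
  shows "unitary_mat n (U * V)"
proof (rule unitary_matI)
  note u = unitary_matD[OF assms(1)] and v = unitary_matD[OF assms(2)]
  show "U * V \<in> carrier_mat n n"
    using u v by auto
  show "adj (U * V) * (U * V) = 1\<^sub>m n"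
    using u v by (simp add: adj_simps mat_ring_simps mult_left_cancel_mat)
qed

text \<open>Complete v to a basis, orthogonalize it by Gram-Schmidt, which keeps the first vector,
  and normalize. The scalar c is the normalizing factor of v.\<close>

lemma exists_unitary_first_col:
  fixes v :: "complex vec"
  assumes v: "v \<in> carrier_vec n" and v0: "v \<noteq> 0\<^sub>v n"
  obtains U c where "unitary_mat n U" "col U 0 = c \<cdot>\<^sub>v v"
proof -
  interpret cof_vec_space n "TYPE(complex)" .
  define b where "b = basis_completion v"
  define ws where "ws = gram_schmidt n b"
  note bc = basis_completion[OF v v0, folded b_def]
  have n: "n \<noteq> 0"
    using v v0 by auto
  then obtain vs where bv: "b = v # vs"
    using bc(6,7) by (cases b) auto
  have ws: "set ws \<subseteq> carrier_vec n" "corthogonal ws" "length ws = n"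
    using gram_schmidt_result[OF bc(2,4,5) refl] bc(6) by (auto simp: ws_def)
  have "hd ws = v"
    using gram_schmidt_hd[OF v, of vs] by (simp add: ws_def bv)
  then have ws0: "ws ! 0 = v"
    using ws(3) n by (cases ws) auto
  have wsc: "ws ! i \<in> carrier_vec n" if "i < n" for i
    using ws(1,3) that nth_mem[of i ws] by auto
  \<comment> \<open>Gram-Schmidt yields orthogonal vectors of arbitrary length: \<open>x i\<close>
    is the squared length of the i-th one and \<open>r i\<close> its reciprocal length.\<close>
  define x where "x i = Re (ws ! i \<bullet>c ws ! i)" for i
  define r where "r i = complex_of_real (1 / sqrt (x i))" for i
  define U where "U = mat_of_cols n (map (\<lambda>i. r i \<cdot>\<^sub>v ws ! i) [0..<n])"
  have U: "U \<in> carrier_mat n n"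
    by (auto simp: U_def)
  have cU: "col U i = r i \<cdot>\<^sub>v ws ! i" if "i < n" for i
    using that wsc[OF that] by (simp add: U_def)
  have rr: "cnj (r i) * r i * (ws ! i \<bullet>c ws ! i) = 1" if i: "i < n" for i
  proof -
    have "ws ! i \<bullet>c ws ! i \<noteq> 0"
      using corthogonalD[OF ws(2), of i i] ws(3) i by auto
    \<comment> \<open>In the order on the complex numbers, \<open>\<ge> 0\<close> also says that the
      number is real.\<close>
    moreover have "ws ! i \<bullet>c ws ! i \<ge> 0"
      by (rule conjugate_square_ge_0_vec)
    ultimately have x: "x i > 0" and eq: "ws ! i \<bullet>c ws ! i = complex_of_real (x i)"
      by (auto simp: x_def less_eq_complex_def complex_eq_iff)
    have "cnj (r i) * r i * (ws ! i \<bullet>c ws ! i) = complex_of_real (1 / sqrt (x i) * (1 / sqrt (x i)) * x i)"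
      by (simp only: r_def eq of_real_mult complex_cnj_complex_of_real)
    also have "1 / sqrt (x i) * (1 / sqrt (x i)) * x i = 1"
      using x by simp
    finally show ?thesis
      by simp
  qed
  have "adj U * U = 1\<^sub>m n"
  proof (rule eq_matI)
    fix i j assume "i < dim_row (1\<^sub>m n)" "j < dim_col (1\<^sub>m n)"
    then have ij: "i < n" "j < n" by auto
    have "row (adj U) i = conjugate (col U i)"
      using U ij by (intro eq_vecI) auto
    then have "(adj U * U) $$ (i, j) = conjugate (r i \<cdot>\<^sub>v ws ! i) \<bullet> (r j \<cdot>\<^sub>v ws ! j)"
      using U ij by (simp add: cU)
    also have "\<dots> = cnj (r i) * r j * (conjugate (ws ! i) \<bullet> ws ! j)"
      using wsc[OF ij(1)] wsc[OF ij(2)] by (simp add: conjugate_smult_vec)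
    also have "conjugate (ws ! i) \<bullet> ws ! j = ws ! j \<bullet>c ws ! i"
      by (rule conjugate_vec_sprod_comm[symmetric, OF wsc[OF ij(2)] wsc[OF ij(1)]])
    also have "cnj (r i) * r j * (ws ! j \<bullet>c ws ! i) = 1\<^sub>m n $$ (i, j)"
      using rr[OF ij(1)] corthogonalD[OF ws(2), of j i] ws(3) ij by auto
    finally show "(adj U * U) $$ (i, j) = 1\<^sub>m n $$ (i, j)" .
  qed (use U in auto)
  then have "unitary_mat n U"
    using U by (rule unitary_matI[rotated])
  moreover have "col U 0 = r 0 \<cdot>\<^sub>v v"
    using cU[of 0] n ws0 by simp
  ultimately show ?thesis
    using that by blast
qed

text \<open>The characteristic polynomial has degree n, hence a root by the fundamental theorem of
  algebra.\<close>

lemma exists_eigenvector: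
  fixes A :: "complex mat"
  assumes A: "A \<in> carrier_mat n n" and n: "n \<noteq> 0"
  obtains v e where "v \<in> carrier_vec n" "v \<noteq> 0\<^sub>v n" "A *\<^sub>v v = e \<cdot>\<^sub>v v"
proof -
  have "degree (char_poly A) \<noteq> 0"
    using degree_monic_char_poly[OF A] n by simp
  then obtain e where "poly (char_poly A) e = 0"
    using fundamental_theorem_of_algebra[of "char_poly A"] constant_degree[of "char_poly A"] by auto
  then have "eigenvalue A e"
    using eigenvalue_root_char_poly[OF A] by simp
  then show ?thesis
    using A that by (auto simp: eigenvalue_def eigenvector_def)
qed

text \<open>Induction on the order. A unitary whose first column is an eigenvector makes the first
  coordinate axis invariant; since the matrix is Hermitian, the complement is invariant too, and the
  induction hypothesis diagonalizes it.\<close>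

theorem hermitian_diagonalization:
  assumes "hermitian_mat A" "A \<in> carrier_mat n n"
  obtains U d where "unitary_mat n U"
    "A = U * mat_diag n (\<lambda>i. complex_of_real (d i)) * adj U"
proof -
  have "\<exists>U d. unitary_mat n U \<and> A = U * mat_diag n (\<lambda>i. complex_of_real (d i)) * adj U"
    using assms
  proof (induction n arbitrary: A)
    case 0
    then have "unitary_mat 0 (1\<^sub>m 0)" "A = 1\<^sub>m 0 * mat_diag 0 (\<lambda>i. complex_of_real 0) * adj (1\<^sub>m 0)"
      by (auto simp: unitary_mat_def)
    then show ?case
      by (intro exI[of _ "1\<^sub>m 0"] exI[of _ "\<lambda>_. 0"] conjI)
  next
    case (Suc m)
    define n where "n = Suc m"
    \<comment> \<open>\<open>P\<close> includes the first coordinate axis and \<open>Q\<close> the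
      other m coordinates.\<close>
    define P where "P = inl_mat 1 m"
    define Q where "Q = inr_mat 1 m"
    have dPQ [simp]: "dim_row P = n" "dim_col P = 1" "dim_row Q = n" "dim_col Q = m"
      by (simp_all add: P_def Q_def n_def)
    note PQ = inl_inr_orthonormal[of 1 m, folded P_def Q_def]
    have PQc: "P * adj P + Q * adj Q = 1\<^sub>m n"
      using inl_inr_complete[of 1 m] by (simp add: P_def Q_def n_def)
    have A: "A \<in> carrier_mat n n" and dA [simp]: "dim_row A = n" "dim_col A = n"
      using Suc.prems by (auto simp: n_def)
    obtain v e where v: "v \<in> carrier_vec n" "v \<noteq> 0\<^sub>v n" "A *\<^sub>v v = e \<cdot>\<^sub>v v"
      using exists_eigenvector[OF A] by (auto simp: n_def)
    obtain W c where W: "unitary_mat n W" and W0: "col W 0 = c \<cdot>\<^sub>v v"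
      using exists_unitary_first_col[OF v(1,2)] .
    note w [simp] = unitary_matD[OF W]
    have Aw: "A *\<^sub>v col W 0 = e \<cdot>\<^sub>v col W 0"
      using v A by (simp add: W0 mult_mat_vec smult_smult_assoc mult.commute)
    have WP: "W * P = mat n 1 (\<lambda>(i, j). col W 0 $ i)"
      by (rule eq_matI) (auto simp: P_def inl_mat_def scalar_prod_def n_def
          if_distrib[of "\<lambda>x. _ * x"] cong: if_cong)
    have AWP: "A * (W * P) = e \<cdot>\<^sub>m (W * P)"
    proof (rule eq_matI)
      fix i j assume "i < dim_row (e \<cdot>\<^sub>m (W * P))" "j < dim_col (e \<cdot>\<^sub>m (W * P))"
      then have ij: "i < n" "j = 0" by auto
      have "col (mat n 1 (\<lambda>(i, j). col W 0 $ i)) 0 = col W 0"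
        by (rule eq_vecI) auto
      then have "(A * (W * P)) $$ (i, j) = (A *\<^sub>v col W 0) $ i"
        using ij by (simp add: WP)
      then show "(A * (W * P)) $$ (i, j) = (e \<cdot>\<^sub>m (W * P)) $$ (i, j)"
        using ij by (simp add: Aw WP)
    qed auto
    \<comment> \<open>In the basis of the columns of \<open>W\<close> the first unit vector becomes
      an eigenvector, which is \<open>BP\<close> below.\<close>
    define B where "B = adj W * A * W"
    have dB [simp]: "dim_row B = n" "dim_col B = n"
      by (simp_all add: B_def)
    have AB: "A = W * B * adj W"
      by (simp add: B_def mat_ring_simps mult_left_cancel_mat)
    have "hermitian_mat B"
      unfolding B_def using Suc.prems A
      by (intro hermitian_mat_square[of _ n _ n]) (auto simp: n_def)
    then have hB: "adj B = B"
      by (simp add: hermitian_mat_def)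
    have BP: "B * P = e \<cdot>\<^sub>m P"
      by (simp add: B_def mat_ring_simps AWP mult_left_cancel_mat)
    have "adj P * B = adj (B * P)"
      by (simp add: adj_mult hB)
    also have "\<dots> = cnj e \<cdot>\<^sub>m adj P"
      by (simp add: BP adj_smult)
    finally have PB: "adj P * B = cnj e \<cdot>\<^sub>m adj P" .
    \<comment> \<open>The eigenvalue is real: \<open>adj P * B * P\<close> is computed in two ways,
      from \<open>PB\<close> and from \<open>BP\<close>.\<close>
    have "cnj e \<cdot>\<^sub>m 1\<^sub>m 1 = e \<cdot>\<^sub>m 1\<^sub>m 1"
    proof -
      have "adj P * B * P = cnj e \<cdot>\<^sub>m 1\<^sub>m 1"
        by (simp add: PB mat_ring_simps PQ)
      moreover have "adj P * (B * P) = e \<cdot>\<^sub>m 1\<^sub>m 1"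
        by (simp add: BP mat_ring_simps PQ)
      ultimately show ?thesis
        by (simp add: mat_ring_simps)
    qed
    from arg_cong[OF this, of "\<lambda>M. M $$ (0, 0)"] have "cnj e = e"
      by simp
    then obtain x where x: "e = complex_of_real x"
      by (metis Reals_cnj_iff Reals_cases)
    define C where "C = adj Q * B * Q"
    have "hermitian_mat C" "C \<in> carrier_mat m m"
      unfolding C_def using \<open>hermitian_mat B\<close>
      by (auto intro!: hermitian_mat_square[of _ n _ m] carrier_matI)
    from Suc.IH[OF this] obtain V d where V: "unitary_mat m V"
      and C: "C = V * mat_diag m (\<lambda>i. complex_of_real (d i)) * adj V"
      by blast
    note v' [simp] = unitary_matD[OF V]
    \<comment> \<open>The off-diagonal block vanishes, so \<open>B\<close> maps the range of
      \<open>Q\<close> into itself and acts there as \<open>C\<close>.\<close>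
    have "adj P * (B * Q) = 0\<^sub>m 1 m"
      using arg_cong[OF PB, of "\<lambda>M. M * Q"]
      by (simp add: mat_ring_simps PQ)
    then have "(P * adj P + Q * adj Q) * (B * Q) = Q * C"
      by (simp add: mat_ring_simps C_def)
    then have BQ: "B * Q = Q * C"
      by (simp add: PQc mat_ring_simps)
    \<comment> \<open>The direct sum of the 1 by 1 identity and \<open>V\<close>.\<close>
    define Z where "Z = P * adj P + Q * V * adj Q"
    have dZ [simp]: "dim_row Z = n" "dim_col Z = n"
      by (simp_all add: Z_def)
    have ZP: "Z * P = P"
      by (simp add: Z_def mat_ring_simps PQ)
    have ZQ: "Z * Q = Q * V"
      by (simp add: Z_def mat_ring_simps PQ)
    have "adj Z * Z = 1\<^sub>m n"
    proof -
      \<comment> \<open>Inserting \<open>P * adj P + Q * adj Q = 1\<close> reduces the claim to the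
        known values of \<open>Z\<close> on \<open>P\<close> and on \<open>Q\<close>;
        \<open>B * Z = Z * D\<close> is obtained in the same way.\<close>
      have "adj Z * Z = adj Z * (Z * (P * adj P + Q * adj Q))"
        by (simp add: PQc mat_ring_simps)
      also have "\<dots> = adj Z * (Z * P) * adj P + adj Z * (Z * Q) * adj Q"
        by (simp add: mat_ring_simps)
      also have "\<dots> = P * adj P + Q * adj Q"
        by (simp add: ZP ZQ)
          (simp add: Z_def adj_simps mat_ring_simps PQ mult_left_cancel_mat mult_left_annihilate_mat)
      finally show ?thesis
        by (simp add: PQc)
    qed
    then have Z: "unitary_mat n Z"
      by (intro unitary_matI carrier_matI) simp_all
    \<comment> \<open>The split-off eigenvalue takes position 0, and those of \<open>C\<close> move
      up by one.\<close>
    define D where "D = mat_diag n (\<lambda>i. complex_of_real (case i of 0 \<Rightarrow> x | Suc j \<Rightarrow> d j))"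
    have D: "D = P * mat_diag 1 (\<lambda>_. e) * adj P + Q * mat_diag m (\<lambda>i. complex_of_real (d i)) * adj Q"
      unfolding D_def P_def Q_def inl_inr_diag x
      by (rule eq_matI) (auto simp: n_def mat_diag_def split: nat.split)
    have dD [simp]: "dim_row D = n" "dim_col D = n"
      by (simp_all add: D_def)
    have "mat_diag 1 (\<lambda>_. e) = e \<cdot>\<^sub>m 1\<^sub>m 1"
      by (rule eq_matI) (auto simp: mat_diag_def)
    then have DP: "D * P = e \<cdot>\<^sub>m P" and DQ: "D * Q = Q * mat_diag m (\<lambda>i. complex_of_real (d i))"
      by (simp_all add: D mat_ring_simps PQ)
    have "B * Z = Z * D"
    proof -
      have "B * Z = B * P * adj P + B * Q * (V * adj Q)"
        by (simp add: Z_def mat_ring_simps)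
      also have "\<dots> = Z * P * (e \<cdot>\<^sub>m adj P) + Z * Q * (mat_diag m (\<lambda>i. complex_of_real (d i)) * adj Q)"
        by (simp add: BP BQ C ZP ZQ mat_ring_simps mult_left_cancel_mat)
      also have "\<dots> = Z * (D * P) * adj P + Z * (D * Q) * adj Q"
        by (simp add: DP DQ mat_ring_simps)
      also have "\<dots> = Z * D * (P * adj P + Q * adj Q)"
        by (simp add: mat_ring_simps)
      finally show ?thesis
        by (simp add: PQc mat_ring_simps)
    qed
    note z = unitary_matD[OF Z]
    have "B = B * (Z * adj Z)"
      by (simp add: z mat_ring_simps)
    also have "\<dots> = Z * D * adj Z"
      using arg_cong[OF \<open>B * Z = Z * D\<close>, of "\<lambda>M. M * adj Z"] by (simp add: mat_ring_simps)
    finally have "A = (W * Z) * D * adj (W * Z)"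
      by (simp add: AB adj_simps mat_ring_simps)
    then show ?case
      using unitary_mat_mult[OF W Z] unfolding D_def n_def by blast
  qed
  then show ?thesis
    using that by blast
qed

subsection \<open>Functional calculus and positivity\<close>

text \<open>In the coordinates \<open>Y = adj U * X * V\<close> the hypothesis reads
  \<open>d i * Y_ij = Y_ij * e j\<close>. So an entry is zero unless \<open>d i = e j\<close>, and
  then \<open>f (d i) = f (e j)\<close>; this works for arbitrary f.\<close>

lemma unitary_diag_intertwine:
  assumes U: "unitary_mat n U" and V: "unitary_mat m V" and X: "X \<in> carrier_mat n m"
    and eq: "U * mat_diag n (\<lambda>i. complex_of_real (d i)) * adj U * X
           = X * (V * mat_diag m (\<lambda>i. complex_of_real (e i)) * adj V)"
  shows "U * mat_diag n (\<lambda>i. complex_of_real (f (d i))) * adj U * X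
           = X * (V * mat_diag m (\<lambda>i. complex_of_real (f (e i))) * adj V)"
proof -
  note uv [simp] = unitary_matD[OF U] unitary_matD[OF V]
  have dX [simp]: "dim_row X = n" "dim_col X = m"
    using X by auto
  define Y where "Y = adj U * X * V"
  have Y: "Y \<in> carrier_mat n m" and dY [simp]: "dim_row Y = n" "dim_col Y = m"
    by (auto simp: Y_def intro: carrier_matI)
  have XY: "X = U * Y * adj V"
    by (simp add: Y_def mat_ring_simps mult_left_cancel_mat)
  have YD: "mat_diag n (\<lambda>i. complex_of_real (d i)) * Y = Y * mat_diag m (\<lambda>i. complex_of_real (e i))"
    using arg_cong[OF eq, of "\<lambda>M. adj U * M * V"]
    by (simp add: XY mat_ring_simps mult_left_cancel_mat)
  have ent: "complex_of_real (d i) * Y $$ (i, j) = Y $$ (i, j) * complex_of_real (e j)"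
    if "i < n" "j < m" for i j
    using arg_cong[OF YD, of "\<lambda>M. M $$ (i, j)"] that
    unfolding mat_diag_mult_left[OF Y] mat_diag_mult_right[OF Y] by simp
  have "mat_diag n (\<lambda>i. complex_of_real (f (d i))) * Y = Y * mat_diag m (\<lambda>i. complex_of_real (f (e i)))"
    unfolding mat_diag_mult_left[OF Y] mat_diag_mult_right[OF Y]
  proof (rule eq_matI)
    fix i j
    assume "i < dim_row (mat n m (\<lambda>(i, j). Y $$ (i, j) * complex_of_real (f (e j))))"
      and "j < dim_col (mat n m (\<lambda>(i, j). Y $$ (i, j) * complex_of_real (f (e j))))"
    then have ij: "i < n" "j < m" by simp_all
    from ent[OF this] have "Y $$ (i, j) = 0 \<or> d i = e j"
      by (simp add: mult.commute)
    then show "mat n m (\<lambda>(i, j). complex_of_real (f (d i)) * Y $$ (i, j)) $$ (i, j)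
        = mat n m (\<lambda>(i, j). Y $$ (i, j) * complex_of_real (f (e j))) $$ (i, j)"
      using ij by auto
  qed simp_all
  then have "U * (mat_diag n (\<lambda>i. complex_of_real (f (d i))) * Y) * adj V
      = U * (Y * mat_diag m (\<lambda>i. complex_of_real (f (e i)))) * adj V"
    by simp
  then show ?thesis
    by (simp add: XY mat_ring_simps mult_left_cancel_mat)
qed

text \<open>Independence of the decomposition, which justifies the \<open>THE\<close>, is the
  intertwining lemma with X = 1 applied to two decompositions of the same matrix.\<close>

lemma mat_fun_diagonal:
  assumes "unitary_mat n U" "A = U * mat_diag n (\<lambda>i. complex_of_real (d i)) * adj U"
  shows "mat_fun f A = U * mat_diag n (\<lambda>i. complex_of_real (f (d i))) * adj U"
proof -
  note u = unitary_matD[OF assms(1)]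
  have n: "dim_row A = n"
    by (simp add: assms(2) u)
  show ?thesis
    unfolding mat_fun_def n
  proof (rule the_equality, goal_cases)
    case 1
    then show ?case
      using assms by blast
  next
    case (2 B)
    then obtain V e where V: "unitary_mat n V"
      and A: "A = V * mat_diag n (\<lambda>i. complex_of_real (e i)) * adj V"
      and B: "B = V * mat_diag n (\<lambda>i. complex_of_real (f (e i))) * adj V"
      by blast
    note v = unitary_matD[OF V]
    have "V * mat_diag n (\<lambda>i. complex_of_real (e i)) * adj V * 1\<^sub>m n
        = 1\<^sub>m n * (U * mat_diag n (\<lambda>i. complex_of_real (d i)) * adj U)"
      using A assms(2) u v by (simp add: mult_mat_one_left mult_mat_one_right)
    from unitary_diag_intertwine[OF V assms(1) _ this, of f] show ?case
      using u v by (simp add: B mult_mat_one_left mult_mat_one_right)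
  qed
qed

text \<open>One pair U, d serves all f at once, so identities between functions of A can be checked
  on the diagonal.\<close>

lemma hermitian_diagonalization_mat_fun:
  assumes "hermitian_mat A" "A \<in> carrier_mat n n"
  obtains U d where "unitary_mat n U"
    "A = U * mat_diag n (\<lambda>i. complex_of_real (d i)) * adj U"
    "\<And>f. mat_fun f A = U * mat_diag n (\<lambda>i. complex_of_real (f (d i))) * adj U"
proof -
  obtain U d where U: "unitary_mat n U" "A = U * mat_diag n (\<lambda>i. complex_of_real (d i)) * adj U"
    by (rule hermitian_diagonalization[OF assms])
  show ?thesis
    by (rule that[OF U mat_fun_diagonal[OF U]])
qed

lemma hermitian_mat_fun:
  assumes "hermitian_mat A" "A \<in> carrier_mat n n"
  shows "mat_fun f A \<in> carrier_mat n n" "dim_row (mat_fun f A) = n" "dim_col (mat_fun f A) = n"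
    "adj (mat_fun f A) = mat_fun f A"
proof -
  obtain U d where U: "unitary_mat n U"
    and f: "mat_fun f A = U * mat_diag n (\<lambda>i. complex_of_real (f (d i))) * adj U"
    by (rule hermitian_diagonalization_mat_fun[OF assms]) blast
  note [simp] = unitary_matD[OF U]
  show "dim_row (mat_fun f A) = n" "dim_col (mat_fun f A) = n" "adj (mat_fun f A) = mat_fun f A"
    by (simp_all add: f adj_simps mat_ring_simps)
  then show "mat_fun f A \<in> carrier_mat n n"
    by (intro carrier_matI)
qed

text \<open>Applied below with X a reflection, an isometry with invariant range, and the inclusion
  of a direct summand.\<close>

lemma mat_fun_intertwine:
  assumes "hermitian_mat A" "A \<in> carrier_mat n n" "hermitian_mat B" "B \<in> carrier_mat m m"
    and "X \<in> carrier_mat n m" "A * X = X * B"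
  shows "mat_fun f A * X = X * mat_fun f B"
proof -
  obtain U d where U: "unitary_mat n U" "A = U * mat_diag n (\<lambda>i. complex_of_real (d i)) * adj U"
    and Uf: "mat_fun f A = U * mat_diag n (\<lambda>i. complex_of_real (f (d i))) * adj U"
    by (rule hermitian_diagonalization_mat_fun[OF assms(1,2)]) blast
  obtain V e where V: "unitary_mat m V" "B = V * mat_diag m (\<lambda>i. complex_of_real (e i)) * adj V"
    and Vf: "mat_fun f B = V * mat_diag m (\<lambda>i. complex_of_real (f (e i))) * adj V"
    by (rule hermitian_diagonalization_mat_fun[OF assms(3,4)]) blast
  show ?thesis
    unfolding Uf Vf
    by (rule unitary_diag_intertwine[OF U(1) V(1) assms(5)]) (use U V assms(6) in simp)
qed

lemma mat_fun_mult:
  assumes "hermitian_mat A" "A \<in> carrier_mat n n"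
  shows "mat_fun f A * mat_fun g A = mat_fun (\<lambda>t. f t * g t) A"
proof -
  obtain U d where U: "unitary_mat n U"
    and f: "\<And>f. mat_fun f A = U * mat_diag n (\<lambda>i. complex_of_real (f (d i))) * adj U"
    by (rule hermitian_diagonalization_mat_fun[OF assms]) blast
  note [simp] = unitary_matD[OF U]
  have "mat_fun f A * mat_fun g A
    = U * (mat_diag n (\<lambda>i. complex_of_real (f (d i))) * mat_diag n (\<lambda>i. complex_of_real (g (d i)))) * adj U"
    by (simp add: f mat_ring_simps mult_left_cancel_mat del: mat_diag_diag)
  then show ?thesis
    by (simp add: f)
qed

lemma mat_fun_id:
  assumes "hermitian_mat A" "A \<in> carrier_mat n n"
  shows "mat_fun (\<lambda>t. t) A = A"
  by (rule hermitian_diagonalization_mat_fun[OF assms]) simp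

lemma mat_fun_one:
  assumes "hermitian_mat A" "A \<in> carrier_mat n n"
  shows "mat_fun (\<lambda>_. 1) A = 1\<^sub>m n"
proof -
  obtain U d where U: "unitary_mat n U"
    and f: "\<And>f. mat_fun f A = U * mat_diag n (\<lambda>i. complex_of_real (f (d i))) * adj U"
    by (rule hermitian_diagonalization_mat_fun[OF assms]) blast
  note [simp] = unitary_matD[OF U]
  show ?thesis
    unfolding f by (simp add: mat_ring_simps)
qed

lemma mat_fun_zero:
  assumes "f 0 = 0"
  shows "mat_fun f (0\<^sub>m n n) = 0\<^sub>m n n"
proof -
  have 0: "mat_diag n (\<lambda>_. complex_of_real 0) = 0\<^sub>m n n"
    by (rule eq_matI) (auto simp: mat_diag_def)
  have "unitary_mat n (1\<^sub>m n)"
    by (simp add: unitary_mat_def)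
  from mat_fun_diagonal[OF this, of "0\<^sub>m n n" "\<lambda>_. 0" f] show ?thesis
    using assms 0 by (simp add: mat_ring_simps)
qed

section \<open>Quadratic forms and positive semidefinite matrices\<close>

lemma cscalar_prod_mult_mat_vec:
  assumes "A \<in> carrier_mat n m" "v \<in> carrier_vec m" "w \<in> carrier_vec n"
  shows "(A *\<^sub>v v) \<bullet>c w = v \<bullet>c (adj A *\<^sub>v w)"
proof -
  have "(A *\<^sub>v v) \<bullet>c w = (\<Sum>i<n. \<Sum>j<m. A $$ (i, j) * v $ j * cnj (w $ i))"
    using assms by (simp add: scalar_prod_def sum_distrib_right lessThan_atLeast0)
  also have "\<dots> = (\<Sum>j<m. \<Sum>i<n. A $$ (i, j) * v $ j * cnj (w $ i))"
    by (rule sum.swap)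
  also have "\<dots> = v \<bullet>c (adj A *\<^sub>v w)"
    using assms by (simp add: scalar_prod_def sum_distrib_left lessThan_atLeast0 mult_ac)
  finally show ?thesis .
qed

lemma cscalar_prod_congruence:
  assumes "A \<in> carrier_mat n n" "X \<in> carrier_mat n m" "v \<in> carrier_vec m"
  shows "((adj X * A * X) *\<^sub>v v) \<bullet>c v = (A *\<^sub>v (X *\<^sub>v v)) \<bullet>c (X *\<^sub>v v)"
proof -
  note adj_carrier[OF assms(2)]
  then have "(adj X * A * X) *\<^sub>v v = (adj X * A) *\<^sub>v (X *\<^sub>v v)"
    using assms by (intro assoc_mult_mat_vec[of _ m n _ m]) auto
  also have "\<dots> = adj X *\<^sub>v (A *\<^sub>v (X *\<^sub>v v))"
    using assms \<open>adj X \<in> carrier_mat m n\<close> by (intro assoc_mult_mat_vec[of _ m n _ n]) auto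
  finally have "(adj X * A * X) *\<^sub>v v = adj X *\<^sub>v (A *\<^sub>v (X *\<^sub>v v))" .
  then show ?thesis
    using assms cscalar_prod_mult_mat_vec[of "adj X" m n "A *\<^sub>v (X *\<^sub>v v)" v]
    by (simp add: adj_carrier)
qed

lemma pos_semidefD:
  assumes "pos_semidef n A"
  shows "hermitian_mat A" "A \<in> carrier_mat n n" "dim_row A = n" "dim_col A = n" "adj A = A"
  using assms by (auto simp: pos_semidef_def hermitian_mat_def)

lemma pos_def_imp_semidef: "pos_def n A \<Longrightarrow> pos_semidef n A"
  unfolding pos_def_def pos_semidef_def
proof (elim conjE, intro conjI ballI)
  fix v :: "complex vec"
  assume A: "A \<in> carrier_mat n n" "\<forall>v\<in>carrier_vec n. v \<noteq> 0\<^sub>v n \<longrightarrow> 0 < Re ((A *\<^sub>v v) \<bullet>c v)"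
    and v: "v \<in> carrier_vec n"
  show "0 \<le> Re ((A *\<^sub>v v) \<bullet>c v)"
  proof (cases "v = 0\<^sub>v n")
    case True
    then show ?thesis
      using A mult_mat_vec_carrier[OF A(1) v] by simp
  next
    case False
    then show ?thesis
      using A v by (meson less_imp_le)
  qed
qed

lemma pos_semidef_congruence:
  assumes "pos_semidef n A" "X \<in> carrier_mat n m"
  shows "pos_semidef m (adj X * A * X)"
  using assms hermitian_mat_square[of A n X m]
  by (auto simp: pos_semidef_def cscalar_prod_congruence adj_carrier)

lemma pos_semidef_one: "pos_semidef n (1\<^sub>m n)"
proof -
  have "Re (v \<bullet>c v) \<ge> 0" for v :: "complex vec"
    using conjugate_square_ge_0_vec[of v] by (simp add: less_eq_complex_def)
  then show ?thesis
    by (simp add: pos_semidef_def hermitian_mat_def)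
qed

lemma pos_semidef_gram:
  assumes "X \<in> carrier_mat n m"
  shows "pos_semidef m (adj X * X)"
  using pos_semidef_congruence[OF pos_semidef_one assms] assms
  by (simp add: mat_ring_simps)

lemma pos_semidef_add:
  assumes "pos_semidef n A" "pos_semidef n B"
  shows "pos_semidef n (A + B)"
  using assms
  by (auto simp: pos_semidef_def hermitian_mat_def adj_simps add_mult_distrib_mat_vec[of _ n n]
      add_scalar_prod_distrib[of _ n])

lemma pos_semidef_smult:
  assumes "pos_semidef n A" "0 \<le> c"
  shows "pos_semidef n (complex_of_real c \<cdot>\<^sub>m A)"
proof -
  have "(complex_of_real c \<cdot>\<^sub>m A) *\<^sub>v v = complex_of_real c \<cdot>\<^sub>v (A *\<^sub>v v)"
    if "v \<in> carrier_vec n" for v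
    using that pos_semidefD[OF assms(1)] by (intro eq_vecI) auto
  then show ?thesis
    using assms by (auto simp: pos_semidef_def hermitian_mat_def adj_simps)
qed

text \<open>\<open>d i\<close> is the value of the quadratic form at the i-th column of U.\<close>

lemma pos_semidef_eigenvalues:
  assumes A: "pos_semidef n A" and U: "unitary_mat n U"
    and eq: "A = U * mat_diag n (\<lambda>i. complex_of_real (d i)) * adj U" and i: "i < n"
  shows "0 \<le> d i" "pos_def n A \<Longrightarrow> 0 < d i"
proof -
  note [simp] = unitary_matD[OF U]
  define w where "w = U *\<^sub>v unit_vec n i"
  have w: "w \<in> carrier_vec n"
    by (simp add: w_def carrier_vecI)
  have "Re ((A *\<^sub>v w) \<bullet>c w) = Re (((adj U * A * U) *\<^sub>v unit_vec n i) \<bullet>c unit_vec n i)"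
    unfolding w_def
    by (subst cscalar_prod_congruence[of A n U n]) (use U pos_semidefD[OF A] in \<open>auto simp: unitary_mat_def\<close>)
  also have "adj U * A * U = mat_diag n (\<lambda>i. complex_of_real (d i))"
    by (simp add: eq mat_ring_simps mult_left_cancel_mat)
  also have "Re ((\<dots> *\<^sub>v unit_vec n i) \<bullet>c unit_vec n i) = d i"
  proof -
    have "conjugate (unit_vec n i) = (unit_vec n i :: complex vec)"
      by (rule eq_vecI) (auto simp: unit_vec_def)
    then show ?thesis
      using i by (simp add: mat_diag_def)
  qed
  finally have d: "Re ((A *\<^sub>v w) \<bullet>c w) = d i" .
  then show "0 \<le> d i"
    using A w by (auto simp: pos_semidef_def)
  \<comment> \<open>\<open>adj U\<close> maps \<open>w\<close> back to a unit vector, so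
    \<open>w\<close> cannot vanish and strict positivity applies to it.\<close>
  have "w \<noteq> 0\<^sub>v n"
  proof
    assume "w = 0\<^sub>v n"
    then have "adj U *\<^sub>v w = 0\<^sub>v n"
      by (intro eq_vecI) (simp_all add: scalar_prod_def)
    moreover have "adj U *\<^sub>v w = (adj U * U) *\<^sub>v unit_vec n i"
      unfolding w_def
      by (rule assoc_mult_mat_vec[symmetric, of _ n n _ n]) (auto intro: carrier_matI)
    ultimately have "unit_vec n i $ i = (0\<^sub>v n $ i :: complex)"
      by simp
    then show False
      using i by simp
  qed
  then show "0 < d i" if "pos_def n A"
    using that w d by (auto simp: pos_def_def)
qed

text \<open>All eigenvalues are positive. This makes identities for \<open>sqrt\<close> and
  \<open>inverse\<close> available that hold only for t > 0.\<close>

lemma mat_fun_cong_pos_def: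
  assumes "pos_def n A" "\<And>t. 0 < t \<Longrightarrow> f t = g t"
  shows "mat_fun f A = mat_fun g A"
proof -
  note A = pos_def_imp_semidef[OF assms(1)]
  obtain U d where U: "unitary_mat n U" "A = U * mat_diag n (\<lambda>i. complex_of_real (d i)) * adj U"
    and f: "\<And>f. mat_fun f A = U * mat_diag n (\<lambda>i. complex_of_real (f (d i))) * adj U"
    by (rule hermitian_diagonalization_mat_fun[OF pos_semidefD(1,2)[OF A]]) blast
  have "mat_diag n (\<lambda>i. complex_of_real (f (d i))) = mat_diag n (\<lambda>i. complex_of_real (g (d i)))"
    using pos_semidef_eigenvalues(2)[OF A U _ assms(1)] assms(2)
    by (intro eq_matI) (auto simp: mat_diag_def)
  then show ?thesis
    by (simp add: f)
qed

text \<open>The factor is \<open>sqrt (f d)\<close> on the diagonal times \<open>adj U\<close>. It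
  serves twice: to show that f(A) is positive, and with f the identity to take a square
  root.\<close>

lemma pos_semidef_factor:
  assumes A: "pos_semidef n A" and f: "\<And>t. 0 \<le> t \<Longrightarrow> 0 \<le> f t"
  obtains E where "E \<in> carrier_mat n n" "mat_fun f A = adj E * E"
proof -
  obtain U d where U: "unitary_mat n U" "A = U * mat_diag n (\<lambda>i. complex_of_real (d i)) * adj U"
    and fA: "\<And>f. mat_fun f A = U * mat_diag n (\<lambda>i. complex_of_real (f (d i))) * adj U"
    by (rule hermitian_diagonalization_mat_fun[OF pos_semidefD(1,2)[OF A]]) blast
  note [simp] = unitary_matD[OF U(1)]
  define S where "S = mat_diag n (\<lambda>i. complex_of_real (sqrt (f (d i))))"
  have dS [simp]: "dim_row S = n" "dim_col S = n" and aS: "adj S = S"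
    by (simp_all add: S_def)
  have "sqrt (f (d i)) * sqrt (f (d i)) = f (d i)" if "i < n" for i
    using pos_semidef_eigenvalues(1)[OF A U that] f by simp
  then have S: "S * S = mat_diag n (\<lambda>i. complex_of_real (f (d i)))"
    unfolding S_def mat_diag_diag of_real_mult[symmetric]
    by (intro eq_matI) (auto simp: mat_diag_def)
  have "mat_fun f A = adj (S * adj U) * (S * adj U)"
    by (simp add: fA S[symmetric] adj_simps aS mat_ring_simps)
  then show ?thesis
    by (rule that[rotated]) (simp add: carrier_matI)
qed

lemma pos_semidef_mat_fun:
  assumes "pos_semidef n A" "\<And>t. 0 \<le> t \<Longrightarrow> 0 \<le> f t"
  shows "pos_semidef n (mat_fun f A)"
proof -
  obtain E where "E \<in> carrier_mat n n" "mat_fun f A = adj E * E"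
    by (rule pos_semidef_factor[OF assms])
  then show ?thesis
    using pos_semidef_gram[of E n n] by simp
qed

subsection \<open>Jensen's operator inequality\<close>

lemma loewner_leD:
  assumes "loewner_le n A B"
  shows "A \<in> carrier_mat n n" "B \<in> carrier_mat n n" "pos_semidef n (B - A)"
    "dim_row A = n" "dim_col A = n" "dim_row B = n" "dim_col B = n"
  using assms by (auto simp: loewner_le_def)

lemma loewner_le_congruence:
  assumes "loewner_le n A B" "X \<in> carrier_mat n m"
  shows "loewner_le m (adj X * A * X) (adj X * B * X)"
proof -
  note [simp] = loewner_leD[OF assms(1)]
  have "pos_semidef m (adj X * (B - A) * X)"
    using assms by (intro pos_semidef_congruence[of n]) auto
  moreover have "adj X * (B - A) * X = adj X * B * X - adj X * A * X"
    using assms(2) by (simp add: mat_ring_simps)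
  ultimately show ?thesis
    using assms by (auto simp: loewner_le_def intro!: carrier_matI)
qed

lemma loewner_le_trans:
  assumes "loewner_le n A B" "loewner_le n B C"
  shows "loewner_le n A C"
proof -
  note [simp] = loewner_leD[OF assms(1)] loewner_leD[OF assms(2)]
  have "(C - B) + (B - A) = C - A"
    by (rule eq_matI) auto
  then show ?thesis
    using pos_semidef_add[of n "C - B" "B - A"] by (simp add: loewner_le_def)
qed

text \<open>The difference is \<open>(1 - c)\<close> times A. This is where
  \<open>2 * h (1/2) \<le> 1\<close> takes effect.\<close>

lemma loewner_le_smult_le_one:
  assumes "pos_semidef n A" "c \<le> 1"
  shows "loewner_le n (complex_of_real c \<cdot>\<^sub>m A) A"
proof -
  note A = pos_semidefD[OF assms(1)]
  have "A - complex_of_real c \<cdot>\<^sub>m A = complex_of_real (1 - c) \<cdot>\<^sub>m A"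
    using A by (intro eq_matI) (auto simp: algebra_simps)
  then show ?thesis
    using A pos_semidef_smult[OF assms(1), of "1 - c"] assms(2) by (simp add: loewner_le_def)
qed

text \<open>With \<open>S = 2 K K* - 1\<close>, the average of \<open>Y\<close> and \<open>S Y S\<close> leaves the range of \<open>K\<close> invariant
  and acts there as the compression of \<open>Y\<close>.\<close>

lemma isometry_jensen:
  assumes conv: "operator_h_inequality h f" and N: "1 \<le> N" and Y: "pos_semidef N Y"
    and K: "K \<in> carrier_mat N n" and KK: "adj K * K = 1\<^sub>m n"
  shows "loewner_le n (mat_fun f (adj K * Y * K))
           (complex_of_real (2 * h (1/2)) \<cdot>\<^sub>m (adj K * mat_fun f Y * K))"
proof -
  have dK [simp]: "dim_row K = N" "dim_col K = n"
    using K by auto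
  note Ys = pos_semidefD[OF Y]
  have dY [simp]: "dim_row Y = N" "dim_col Y = N"
    using Ys by auto
  define S where "S = complex_of_real 2 \<cdot>\<^sub>m (K * adj K) - 1\<^sub>m N"
  have dS [simp]: "dim_row S = N" "dim_col S = N" and S: "S \<in> carrier_mat N N"
    by (simp_all add: S_def carrier_matI)
  have aS: "adj S = S"
    by (simp add: S_def adj_simps)
  have SK: "S * K = K"
  proof -
    have "S * K = complex_of_real 2 \<cdot>\<^sub>m K - K"
      by (simp add: S_def mat_ring_simps KK)
    also have "\<dots> = K"
      by (rule eq_matI) auto
    finally show ?thesis .
  qed
  have SS: "S * S = 1\<^sub>m N"
  proof -
    have "S * S = complex_of_real 2 \<cdot>\<^sub>m (S * K * adj K) - S"
      by (subst (2) S_def) (simp add: mat_ring_simps)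
    also have "\<dots> = 1\<^sub>m N"
      unfolding SK by (rule eq_matI) (simp_all add: S_def)
    finally show ?thesis .
  qed
  define Z where "Z = S * Y * S"
  have Z: "pos_semidef N Z"
    unfolding Z_def using pos_semidef_congruence[OF Y S] by (simp add: aS)
  note Zs = pos_semidefD[OF Z]
  have dZ [simp]: "dim_row Z = N" "dim_col Z = N"
    using Zs by auto
  \<comment> \<open>The coefficient \<open>1 - 1/2\<close> is left unevaluated to match the
    convexity inequality at \<alpha> = 1/2.\<close>
  define M where "M = complex_of_real (1/2) \<cdot>\<^sub>m Y + complex_of_real (1 - 1/2) \<cdot>\<^sub>m Z"
  have M: "pos_semidef N M"
    unfolding M_def by (intro pos_semidef_add pos_semidef_smult Y Z) auto
  note Ms = pos_semidefD[OF M]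
  have le: "loewner_le N (mat_fun f M)
      (complex_of_real (h (1/2)) \<cdot>\<^sub>m mat_fun f Y + complex_of_real (h (1 - 1/2)) \<cdot>\<^sub>m mat_fun f Z)"
    unfolding M_def
    by (rule conv[unfolded operator_h_inequality_def, rule_format]) (use N Y Z in auto)
  note [simp] = hermitian_mat_fun(2,3)[OF Ys(1,2)] hermitian_mat_fun(2,3)[OF Zs(1,2)]
    hermitian_mat_fun(2,3)[OF Ms(1,2)]
  have ZS: "mat_fun f Z * S = S * mat_fun f Y"
    by (rule mat_fun_intertwine[OF Zs(1,2) Ys(1,2) S]) (simp add: Z_def mat_ring_simps SS)
  \<comment> \<open>Since \<open>S\<close> fixes \<open>K\<close>, f(Z) and f(Y) have the same
    compression; the two terms with \<open>h (1/2)\<close> therefore add up to the factor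
    \<open>2 * h (1/2)\<close>.\<close>
  have fZ: "adj K * mat_fun f Z * K = adj K * mat_fun f Y * K"
  proof -
    have "adj K * mat_fun f Z * K = adj K * (mat_fun f Z * S) * K"
      by (simp add: mat_ring_simps SK)
    also have "\<dots> = (adj K * S) * mat_fun f Y * K"
      by (simp add: mat_ring_simps ZS)
    also have "adj K * S = adj K"
      using arg_cong[OF SK, of adj] by (simp add: adj_mult aS)
    finally show ?thesis .
  qed
  have hC: "hermitian_mat (adj K * Y * K)" and cC: "adj K * Y * K \<in> carrier_mat n n"
    using hermitian_mat_square[OF Ys(1,2) K] by (auto intro: carrier_matI)
  \<comment> \<open>\<open>(1 + S) / 2\<close> is the projection \<open>K * adj K\<close>, which
    makes the range of \<open>K\<close> invariant under \<open>M\<close>.\<close>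
  have "M * K = complex_of_real (1/2) \<cdot>\<^sub>m (Y * K + S * (Y * K))"
    by (simp add: M_def Z_def mat_ring_simps SK) (rule eq_matI, auto simp: algebra_simps)
  also have "\<dots> = K * (adj K * Y * K)"
    by (simp add: S_def mat_ring_simps) (rule eq_matI, auto simp: algebra_simps)
  finally have "mat_fun f M * K = K * mat_fun f (adj K * Y * K)"
    by (intro mat_fun_intertwine[OF Ms(1,2) hC cC K])
  then have fM: "adj K * mat_fun f M * K = mat_fun f (adj K * Y * K)"
    using hermitian_mat_fun(2)[OF hC cC] by (simp add: mat_ring_simps mult_left_cancel_mat KK)
  have "adj K * (complex_of_real (h (1/2)) \<cdot>\<^sub>m mat_fun f Y + complex_of_real (h (1 - 1/2)) \<cdot>\<^sub>m mat_fun f Z) * K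
     = complex_of_real (h (1/2)) \<cdot>\<^sub>m (adj K * mat_fun f Y * K)
       + complex_of_real (h (1/2)) \<cdot>\<^sub>m (adj K * mat_fun f Z * K)"
    by (simp add: mat_ring_simps)
  also have "\<dots> = complex_of_real (2 * h (1/2)) \<cdot>\<^sub>m (adj K * mat_fun f Y * K)"
    unfolding fZ by (rule eq_matI) auto
  finally show ?thesis
    using loewner_le_congruence[OF le K] by (simp add: fM)
qed

text \<open>By \<open>CE\<close>, stacking C over E gives an isometry \<open>K\<close> into the
  doubled space. Compressing the direct sum of A and B by \<open>K\<close> gives the two sums in the
  claim, so \<open>isometry_jensen\<close> applies.\<close>

theorem hansen_pedersen_jensen:
  assumes conv: "operator_h_inequality h f" and n: "1 \<le> n"
    and A: "pos_semidef n A" and B: "pos_semidef n B"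
    and C: "C \<in> carrier_mat n n" and E: "E \<in> carrier_mat n n"
    and CE: "adj C * C + adj E * E = 1\<^sub>m n"
  shows "loewner_le n (mat_fun f (adj C * A * C + adj E * B * E))
           (complex_of_real (2 * h (1/2)) \<cdot>\<^sub>m (adj C * mat_fun f A * C + adj E * mat_fun f B * E))"
proof -
  define P where "P = inl_mat n n"
  define Q where "Q = inr_mat n n"
  have dPQ [simp]: "dim_row P = n + n" "dim_col P = n" "dim_row Q = n + n" "dim_col Q = n"
    by (simp_all add: P_def Q_def)
  have cP: "P \<in> carrier_mat (n + n) n" "Q \<in> carrier_mat (n + n) n"
    by (auto intro: carrier_matI)
  note PQ [simp] = inl_inr_orthonormal[of n n, folded P_def Q_def]
  note As = pos_semidefD[OF A] and Bs = pos_semidefD[OF B]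
  note [simp] = As(3,4) Bs(3,4) hermitian_mat_fun(2,3)[OF As(1,2)] hermitian_mat_fun(2,3)[OF Bs(1,2)]
  have dCE [simp]: "dim_row C = n" "dim_col C = n" "dim_row E = n" "dim_col E = n"
    using C E by auto
  define K where "K = P * C + Q * E"
  \<comment> \<open>The direct sum of A and B, written with double adjoints to fit
    \<open>pos_semidef_congruence\<close>.\<close>
  define Y where "Y = adj (adj P) * A * adj P + adj (adj Q) * B * adj Q"
  have dY [simp]: "dim_row Y = n + n" "dim_col Y = n + n"
    by (simp_all add: Y_def)
  have K: "K \<in> carrier_mat (n + n) n" and dK [simp]: "dim_row K = n + n" "dim_col K = n"
    by (auto simp: K_def intro: carrier_matI)
  have aKP: "adj K * P = adj C" and aKQ: "adj K * Q = adj E"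
    by (simp_all add: K_def adj_simps mat_ring_simps)
  have KK: "adj K * K = 1\<^sub>m n"
  proof -
    have "adj K * K = adj K * P * C + adj K * Q * E"
      by (subst (2) K_def) (simp add: mat_ring_simps)
    then show ?thesis
      by (simp add: aKP aKQ CE)
  qed
  have Y: "pos_semidef (n + n) Y"
    unfolding Y_def
    by (intro pos_semidef_add pos_semidef_congruence[OF A] pos_semidef_congruence[OF B] adj_carrier cP)
  note Ys = pos_semidefD[OF Y]
  note [simp] = hermitian_mat_fun(2,3)[OF Ys(1,2)]
  have YP: "Y * P = P * A" and YQ: "Y * Q = Q * B"
    by (simp_all add: Y_def mat_ring_simps)
  have fP: "mat_fun f Y * P = P * mat_fun f A"
    by (rule mat_fun_intertwine[OF Ys(1,2) As(1,2) cP(1) YP])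
  have fQ: "mat_fun f Y * Q = Q * mat_fun f B"
    by (rule mat_fun_intertwine[OF Ys(1,2) Bs(1,2) cP(2) YQ])
  have "adj K * Y * K = adj K * (Y * P) * C + adj K * (Y * Q) * E"
    by (subst (2) K_def) (simp add: mat_ring_simps)
  also have "\<dots> = (adj K * P) * A * C + (adj K * Q) * B * E"
    unfolding YP YQ by (simp add: mat_ring_simps)
  finally have 1: "adj K * Y * K = adj C * A * C + adj E * B * E"
    by (simp add: aKP aKQ)
  have "adj K * mat_fun f Y * K = adj K * (mat_fun f Y * P) * C + adj K * (mat_fun f Y * Q) * E"
    by (subst (2) K_def) (simp add: mat_ring_simps)
  also have "\<dots> = (adj K * P) * mat_fun f A * C + (adj K * Q) * mat_fun f B * E"
    unfolding fP fQ by (simp add: mat_ring_simps)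
  finally have 2: "adj K * mat_fun f Y * K = adj C * mat_fun f A * C + adj E * mat_fun f B * E"
    by (simp add: aKP aKQ)
  show ?thesis
    using isometry_jensen[OF conv _ Y K KK] n by (simp add: 1 2)
qed

section \<open>The quotient f(t)/t and operator convexity\<close>

text \<open>\<open>t * inverse t = 1\<close> on the positive eigenvalues, so
  \<open>mat_fun inverse A\<close> is an inverse of A, and inverses are unique. This brings
  \<open>mat_inv\<close> into the functional calculus.\<close>

lemma mat_inv_pos_def:
  assumes "pos_def n A"
  shows "mat_inv A = mat_fun inverse A"
proof -
  note A = pos_semidefD[OF pos_def_imp_semidef[OF assms]]
  note F = hermitian_mat_fun[OF A(1,2), of inverse]
  have "mat_fun (\<lambda>t. t) A * mat_fun inverse A = mat_fun (\<lambda>_. 1) A"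
    unfolding mat_fun_mult[OF A(1,2)] by (rule mat_fun_cong_pos_def[OF assms]) simp
  then have r: "A * mat_fun inverse A = 1\<^sub>m n"
    by (simp add: mat_fun_id[OF A(1,2)] mat_fun_one[OF A(1,2)])
  then have l: "mat_fun inverse A * A = 1\<^sub>m n"
    using mat_mult_left_right_inverse[OF A(2) F(1)] by simp
  \<comment> \<open>Being a unit excludes the result \<open>None\<close> of
    \<open>mat_inverse\<close>.\<close>
  have "A \<in> Units (ring_mat TYPE(complex) n ())"
    using A(2) F(1) r l by (auto simp: Units_def ring_mat_def)
  then obtain B where B: "mat_inverse A = Some B"
    using mat_inverse(1)[OF A(2)] by fastforce
  then have B': "A * B = 1\<^sub>m n" "B \<in> carrier_mat n n"
    using mat_inverse(2)[OF A(2)] by blast+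
  have "B = mat_fun inverse A * (A * B)"
    by (rule mult_left_cancel_mat[OF l, symmetric]) (use A B' F in auto)
  also have "\<dots> = mat_fun inverse A"
    using F by (simp add: B' mat_ring_simps)
  finally show ?thesis
    by (simp add: mat_inv_def B)
qed

text \<open>Put \<open>C = B\<^sup>-\<^sup>1\<^sup>/\<^sup>2 A\<^sup>1\<^sup>/\<^sup>2\<close>, so that \<open>A = C* B C\<close>. It is a contraction because \<open>C C* \<le> 1\<close>.\<close>

lemma quotient_inequality:
  assumes conv: "operator_h_inequality h f" and f0: "f 0 = 0" and n: "1 \<le> n"
    and A: "pos_def n A" and B: "pos_def n B" and AB: "loewner_le n A B"
  shows "loewner_le n (mat_fun (\<lambda>t. inverse t * f t) A)
           (complex_of_real (2 * h (1/2)) \<cdot>\<^sub>m mat_fun (\<lambda>t. inverse t * f t) B)"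
proof -
  note Ap = pos_def_imp_semidef[OF A] and Bp = pos_def_imp_semidef[OF B]
  note As = pos_semidefD[OF Ap] and Bs = pos_semidefD[OF Bp]
  \<comment> \<open>\<open>r\<close>, \<open>r'\<close> and \<open>q'\<close> are the powers 1/2 and
    -1/2 of A and the power -1/2 of B.\<close>
  define r where "r = mat_fun sqrt A"
  define r' where "r' = mat_fun (\<lambda>t. inverse (sqrt t)) A"
  define q' where "q' = mat_fun (\<lambda>t. inverse (sqrt t)) B"
  note mA = hermitian_mat_fun[OF As(1,2)] and mB = hermitian_mat_fun[OF Bs(1,2)]
  note [simp] = As(3,4) Bs(3,4) mA(2,3) mB(2,3)
  have [simp]: "dim_row r = n" "dim_col r = n" "dim_row r' = n" "dim_col r' = n"
      "dim_row q' = n" "dim_col q' = n" "adj r = r" "adj r' = r'" "adj q' = q'"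
    by (simp_all add: r_def r'_def q'_def mA(4) mB(4))
  \<comment> \<open>With c = f t this gives the quotient f(t)/t, and with c = t the constant
    1.\<close>
  have sq: "inverse (sqrt t) * c * inverse (sqrt t) = inverse t * c" if "0 < t" for c t :: real
  proof -
    have "inverse (sqrt t) * c * inverse (sqrt t) = inverse (sqrt t * sqrt t) * c"
      by (simp only: inverse_mult_distrib mult_ac)
    then show ?thesis
      using that by simp
  qed
  have rr: "r * r = A"
  proof -
    have "r * r = mat_fun (\<lambda>t. t) A"
      unfolding r_def mat_fun_mult[OF As(1,2)]
      by (rule mat_fun_cong_pos_def[OF A]) simp
    then show ?thesis
      by (simp add: mat_fun_id[OF As(1,2)])
  qed
  have rr': "r * r' = 1\<^sub>m n"
  proof -
    have "r * r' = mat_fun (\<lambda>t. 1) A"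
      unfolding r_def r'_def mat_fun_mult[OF As(1,2)]
      by (rule mat_fun_cong_pos_def[OF A]) simp
    then show ?thesis
      by (simp add: mat_fun_one[OF As(1,2)])
  qed
  have qBq: "q' * B * q' = 1\<^sub>m n"
  proof -
    have "q' * mat_fun (\<lambda>t. t) B * q' = mat_fun (\<lambda>t. 1) B"
      unfolding q'_def mat_fun_mult[OF Bs(1,2)]
      by (rule mat_fun_cong_pos_def[OF B]) (simp add: sq)
    then show ?thesis
      by (simp add: mat_fun_one[OF Bs(1,2)] mat_fun_id[OF Bs(1,2)])
  qed
  have rfr: "r' * mat_fun f A * r' = mat_fun (\<lambda>t. inverse t * f t) A"
    unfolding r'_def mat_fun_mult[OF As(1,2)]
    by (rule mat_fun_cong_pos_def[OF A]) (rule sq)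
  have qfq: "q' * mat_fun f B * q' = mat_fun (\<lambda>t. inverse t * f t) B"
    unfolding q'_def mat_fun_mult[OF Bs(1,2)]
    by (rule mat_fun_cong_pos_def[OF B]) (rule sq)
  define C where "C = q' * r"
  have dC [simp]: "dim_row C = n" "dim_col C = n" and C: "C \<in> carrier_mat n n"
    by (auto simp: C_def intro: carrier_matI)
  have aC: "adj C = r * q'"
    by (simp add: C_def adj_mult)
  have CBC: "adj C * B * C = A"
  proof -
    have "adj C * B * C = r * (q' * B * q') * r"
      by (simp add: C_def adj_mult mat_ring_simps)
    then show ?thesis
      by (simp only: qBq) (simp add: mat_ring_simps rr)
  qed
  have Cr: "C * r' = q'"
    by (simp add: C_def mat_ring_simps rr')
  have "C * adj C = q' * (r * r) * q'"
    by (simp add: C_def adj_mult mat_ring_simps)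
  then have CC: "C * adj C = q' * A * q'"
    by (simp only: rr)
  \<comment> \<open>Congruence by \<open>q'\<close> turns A \<le> B into \<open>C * adj C\<close>
    \<le> 1.\<close>
  have "loewner_le n (q' * A * q') (q' * B * q')"
    using loewner_le_congruence[OF AB, of q' n] by (simp add: carrier_matI)
  then have co: "pos_semidef n (1\<^sub>m n - C * adj C)"
    by (simp add: loewner_le_def CC qBq)
  define X where "X = 1\<^sub>m n - adj C * C"
  have dX [simp]: "dim_row X = n" "dim_col X = n" and aX: "adj X = X"
    by (simp_all add: X_def adj_simps)
  \<comment> \<open>Passes from \<open>C * adj C\<close> \<le> 1 to \<open>adj C * C\<close> \<le>
    1: with T = \<open>adj C * C\<close>, the two summands are 1 - 2 T + T^2 and T - T^2.\<close>
  have "X = adj X * X + adj C * (1\<^sub>m n - C * adj C) * C"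
    unfolding aX
    by (simp add: X_def mat_ring_simps) (rule eq_matI, simp_all)
  moreover have "pos_semidef n (adj X * X + adj C * (1\<^sub>m n - C * adj C) * C)"
    by (intro pos_semidef_add pos_semidef_gram[of _ n] pos_semidef_congruence[OF co C])
      (simp add: carrier_matI)
  ultimately have X: "pos_semidef n X"
    by simp
  \<comment> \<open>\<open>E\<close> is a square root of the defect \<open>1 - adj C * C\<close>, so
    that \<open>C\<close> and \<open>E\<close> satisfy the hypothesis of Jensen's
    inequality.\<close>
  obtain E where E: "E \<in> carrier_mat n n" and EX: "mat_fun (\<lambda>t. t) X = adj E * E"
    using pos_semidef_factor[OF X, of "\<lambda>t. t"] by auto
  have "adj E * E = X"
    using EX mat_fun_id[OF pos_semidefD(1,2)[OF X]] by simp
  then have CE: "adj C * C + adj E * E = 1\<^sub>m n"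
    by (simp add: X_def) (rule eq_matI, simp_all)
  have [simp]: "dim_row E = n" "dim_col E = n"
    using E by auto
  have zero: "pos_semidef n (0\<^sub>m n n)"
    using pos_semidef_gram[of "0\<^sub>m n n" n n] by (simp add: mat_ring_simps)
  \<comment> \<open>The second matrix is zero; its terms vanish on both sides, on the right because
    f(0) = 0.\<close>
  have "loewner_le n (mat_fun f A) (complex_of_real (2 * h (1/2)) \<cdot>\<^sub>m (adj C * mat_fun f B * C))"
    using hansen_pedersen_jensen[OF conv n Bp zero C E CE]
    by (simp add: CBC mat_fun_zero[of f, OF f0] mult_mat_zero_left mult_mat_zero_right add_mat_zero_right)
  \<comment> \<open>Congruence by \<open>r'\<close> yields the quotient at A on the left; as
    \<open>C * r' = q'\<close>, it yields the quotient at B on the right.\<close>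
  from loewner_le_congruence[OF this, of r' n]
  have "loewner_le n (r' * mat_fun f A * r')
      (r' * (complex_of_real (2 * h (1/2)) \<cdot>\<^sub>m (adj C * mat_fun f B * C)) * r')"
    by (simp add: carrier_matI)
  moreover have "r' * (complex_of_real (2 * h (1/2)) \<cdot>\<^sub>m (adj C * mat_fun f B * C)) * r'
      = complex_of_real (2 * h (1/2)) \<cdot>\<^sub>m ((r' * adj C) * mat_fun f B * (C * r'))"
    by (simp add: mat_ring_simps)
  moreover have "r' * adj C = q'"
    using arg_cong[OF Cr, of adj] by (simp add: adj_mult)
  ultimately show ?thesis
    by (simp add: Cr rfr qfq)
qed

text \<open>Since f is non-negative, the convex combination of f(A) and f(B) is positive
  semidefinite, and the factor \<open>2 * h (1/2)\<close> in front of it can be replaced by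
  1.\<close>

lemma operator_h_inequality_convex:
  assumes conv: "operator_h_inequality h f" and nonneg: "\<And>t. 0 \<le> t \<Longrightarrow> 0 \<le> f t"
    and h: "2 * h (1/2) \<le> 1"
  shows "operator_h_inequality (\<lambda>\<alpha>. \<alpha>) f"
  unfolding operator_h_inequality_def
proof (intro allI impI)
  fix n :: nat and A B and \<alpha> :: real
  assume n: "1 \<le> n" and A: "pos_semidef n A" and B: "pos_semidef n B" and \<alpha>: "0 < \<alpha>" "\<alpha> < 1"
  note As = pos_semidefD[OF A] and Bs = pos_semidefD[OF B]
  note [simp] = As(3,4) Bs(3,4) hermitian_mat_fun(2,3)[OF As(1,2)] hermitian_mat_fun(2,3)[OF Bs(1,2)]
  \<comment> \<open>Congruence by the scalar matrix \<open>sqrt c\<close> is multiplication by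
    c.\<close>
  have sq: "adj (complex_of_real (sqrt c) \<cdot>\<^sub>m 1\<^sub>m n) * X * (complex_of_real (sqrt c) \<cdot>\<^sub>m 1\<^sub>m n) = complex_of_real c \<cdot>\<^sub>m X"
    if "0 \<le> c" "dim_row X = n" "dim_col X = n" for c X
  proof -
    have "complex_of_real (sqrt c) * complex_of_real (sqrt c) = complex_of_real c"
      using that(1) by (simp flip: of_real_mult)
    then show ?thesis
      using that(2,3) by (simp add: adj_smult mat_ring_simps) (rule eq_matI, simp_all flip: mult.assoc)
  qed
  have "adj (complex_of_real (sqrt \<alpha>) \<cdot>\<^sub>m 1\<^sub>m n) * (complex_of_real (sqrt \<alpha>) \<cdot>\<^sub>m 1\<^sub>m n)
      + adj (complex_of_real (sqrt (1 - \<alpha>)) \<cdot>\<^sub>m 1\<^sub>m n) * (complex_of_real (sqrt (1 - \<alpha>)) \<cdot>\<^sub>m 1\<^sub>m n) = 1\<^sub>m n"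
    using sq[of \<alpha> "1\<^sub>m n"] sq[of "1 - \<alpha>" "1\<^sub>m n"] \<alpha>
    by (simp add: mult_mat_one_right) (rule eq_matI, auto)
  from hansen_pedersen_jensen[OF conv n A B _ _ this]
  have "loewner_le n (mat_fun f (complex_of_real \<alpha> \<cdot>\<^sub>m A + complex_of_real (1 - \<alpha>) \<cdot>\<^sub>m B))
      (complex_of_real (2 * h (1/2)) \<cdot>\<^sub>m (complex_of_real \<alpha> \<cdot>\<^sub>m mat_fun f A + complex_of_real (1 - \<alpha>) \<cdot>\<^sub>m mat_fun f B))"
    using sq \<alpha> by simp
  moreover have "pos_semidef n (complex_of_real \<alpha> \<cdot>\<^sub>m mat_fun f A + complex_of_real (1 - \<alpha>) \<cdot>\<^sub>m mat_fun f B)"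
    using \<alpha> by (intro pos_semidef_add pos_semidef_smult pos_semidef_mat_fun A B nonneg) auto
  ultimately show "loewner_le n (mat_fun f (complex_of_real \<alpha> \<cdot>\<^sub>m A + complex_of_real (1 - \<alpha>) \<cdot>\<^sub>m B))
      (complex_of_real \<alpha> \<cdot>\<^sub>m mat_fun f A + complex_of_real (1 - \<alpha>) \<cdot>\<^sub>m mat_fun f B)"
    using loewner_le_trans loewner_le_smult_le_one[OF _ h] by blast
qed

theorem corollary3p9:
  fixes J :: "real set" and h f :: "real \<Rightarrow> real"
  assumes "is_interval J" and "J \<subseteq> {0..}" and "{0<..<1} \<subseteq> J"
    and "\<And>x. x \<in> J \<Longrightarrow> 0 \<le> h x"
    and "\<exists>x \<in> J. h x \<noteq> 0"
    and "super_multiplicative_on J h"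
    and "operator_1h_convex h f"
    and "f 0 = 0"
  shows "(\<forall>n \<ge> 1. \<forall>A B. pos_def n A \<longrightarrow> pos_def n B \<longrightarrow> loewner_le n A B \<longrightarrow>
            loewner_le n (mat_inv A * mat_fun f A)
              (complex_of_real (2 * h (1/2)) \<cdot>\<^sub>m (mat_inv B * mat_fun f B)))
       \<and> (2 * h (1/2) \<le> 1 \<longrightarrow>
            operator_monotone_pos (\<lambda>t. inverse t * f t) \<and> operator_convex f)"
proof -
  have conv: "operator_h_inequality h f" and cont: "continuous_on {0..} f"
    and nonneg: "\<And>t. 0 \<le> t \<Longrightarrow> 0 \<le> f t"
    using assms(7) by (auto simp: operator_1h_convex_def)
  let ?g = "\<lambda>t. inverse t * f t"
  have quot: "mat_inv A * mat_fun f A = mat_fun ?g A" if "pos_def n A" for n A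
    using mat_fun_mult[of A n inverse f] pos_semidefD[OF pos_def_imp_semidef[OF that]]
    by (simp add: mat_inv_pos_def[OF that])
  show ?thesis
  proof (intro conjI allI impI)
    fix n :: nat and A B
    assume "1 \<le> n" "pos_def n A" "pos_def n B" "loewner_le n A B"
    then show "loewner_le n (mat_inv A * mat_fun f A)
        (complex_of_real (2 * h (1/2)) \<cdot>\<^sub>m (mat_inv B * mat_fun f B))"
      unfolding quot[OF \<open>pos_def n A\<close>] quot[OF \<open>pos_def n B\<close>]
      by (rule quotient_inequality[OF conv assms(8)])
  next
    assume h: "2 * h (1/2) \<le> 1"
    show "operator_monotone_pos ?g"
      unfolding operator_monotone_pos_def
    proof (intro allI impI)
      fix n :: nat and A B
      assume AB: "1 \<le> n" "pos_def n A" "pos_def n B" "loewner_le n A B"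
      \<comment> \<open>The quotient is non-negative for all t \<ge> 0; at t = 0 it is 0 because
        \<open>inverse 0 = 0\<close>.\<close>
      have "pos_semidef n (mat_fun ?g B)"
        by (rule pos_semidef_mat_fun[OF pos_def_imp_semidef[OF AB(3)]]) (simp add: nonneg)
      then show "loewner_le n (mat_fun ?g A) (mat_fun ?g B)"
        using quotient_inequality[OF conv assms(8) AB] loewner_le_smult_le_one[OF _ h]
          loewner_le_trans by blast
    qed
    \<comment> \<open>Convexity comes straight from Jensen's inequality with scalar \<open>C\<close>
      and \<open>E\<close>.\<close>
    show "operator_convex f"
      unfolding operator_convex_def
      using cont operator_h_inequality_convex[OF conv nonneg h] by blast
  qed
qed

end
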